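(* For any $r_0\in(0,1)$, $$\theta(r_0)\le \max\left\{\max_{r\in(r_0,1)} 16\,\mathcal{B}_{\hat n}\!\left(\left\lceil \tfrac1r\right\rceil,\tfrac1{20}\right),\,512\right\}.$$
   Context: Let $\mathcal X$ be an instance space and $\mathcal Y=\{-1,+1\}$. A classifier is a measurable function $h:\mathcal X\to\mathcal Y$. Fix a set $\mathcal F$ of classifiers and a probability measure $P$ on $\mathcal X\times\mathcal Y$. Realizable case: there is a target function $f^*\in\mathcal F$ with $\mathbb P(Y=f^*(x)\mid X=x)=1$ for all $x\in\mathcal X$, where $(X,Y)\sim P$. For a set $\mathcal H$ of classifiers, $\mathrm{DIS}(\mathcal H)=\{x\in\mathcal X:\exists h,g\in\mathcal H,\ h(x)\ne g(x)\}$ and $\Delta\mathcal H=P(\mathrm{DIS}(\mathcal H)\times\mathcal Y)$. Let $(x_1,y_1),(x_2,y_2),\ldots$ be i.i.d. with distribution $P$, $S_m=\{(x_1,y_1),\ldots,(x_m,y_m)\}$, and suppose $y_i=f^*(x_i)$ for all $i$ (true with probability 1). For a finite sample $S$, the version space is $\mathrm{VS}_{\mathcal F,S}=\{h\in\mathcal F:\forall (x,y)\in S,\ h(x)=y\}$. The version space compression set size $\hat n(S)=\hat n(\mathcal F,S)$ is the size of a smallest subset $C\subseteq S$ with $\mathrm{VS}_{\mathcal F,C}=\mathrm{VS}_{\mathcal F,S}$. For $m\in\mathbb N\cup\{0\}$, $\delta\in(0,1]$, define $$\mathcal B_{\hat n}(m,\delta)=\min\{b\in\mathbb N\cup\{0\}:\mathbb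 P(\hat n(S_m)\le b)\ge 1-\delta\}.$$ For a classifier $f$ and $r>0$, $\mathrm B(f,r)=\{h\in\mathcal F:\Delta\{h,f\}\le r\}$. The disagreement coefficient is, for $r_0\ge 0$, $\theta(r_0)=\sup_{r>r_0}\frac{\Delta \mathrm B(f^*,r)}{r}\vee 1$, where $a\vee b=\max\{a,b\}$.
   Formalization: Adds the assumption that, for each m, the set of (x_1,…,x_m,x) with x in DIS(VS_{F,S_m}), labels given by f*, is jointly measurable; without it the claim fails for some uncountable F (initial segments of a well-order with countable initial segments). *)

theory Defs
  imports "HOL-Probability.Probability"
begin

definition label_space :: "int measure" where
  "label_space = count_space {-1, 1}"

definition classifiers :: "'a measure \<Rightarrow> ('a \<Rightarrow> int) set" where
  "classifiers M = M \<rightarrow>\<^sub>M label_space"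

text \<open>
  \<open>K\<close> is a version of the conditional distribution of \<open>Y\<close> given \<open>X\<close>, for \<open>(X, Y)\<close> distributed as \<open>P\<close>.
\<close>
definition cond_label_distr ::
    "'a measure \<Rightarrow> ('a \<times> int) measure \<Rightarrow> ('a \<Rightarrow> int measure) \<Rightarrow> bool" where
  "cond_label_distr M P K \<longleftrightarrow>
     K \<in> M \<rightarrow>\<^sub>M prob_algebra label_space \<and>
     (\<forall>A\<in>sets M. \<forall>B\<in>sets label_space.
        emeasure P (A \<times> B) = (\<integral>\<^sup>+x. emeasure (K x) B * indicator A x \<partial>distr P M fst))"

text \<open>
  Conditional distributions are unique only up to null sets, so the pointwise condition
  \<open>P(Y = f x | X = x) = 1\<close> for all \<open>x\<close> is required of some version.
\<close>
definition realizable_by :: "'a measure \<Rightarrow> ('a \<times> int) measure \<Rightarrow> ('a \<Rightarrow> int) \<Rightarrow> bool" where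
  "realizable_by M P f \<longleftrightarrow>
     (\<exists>K. cond_label_distr M P K \<and> (\<forall>x\<in>space M. measure (K x) {f x} = 1))"

definition DIS :: "'a measure \<Rightarrow> ('a \<Rightarrow> int) set \<Rightarrow> 'a set" where
  "DIS M H = {x \<in> space M. \<exists>h\<in>H. \<exists>g\<in>H. h x \<noteq> g x}"

definition Delta :: "'a measure \<Rightarrow> ('a \<times> int) measure \<Rightarrow> ('a \<Rightarrow> int) set \<Rightarrow> real" where
  "Delta M P H = measure P (DIS M H \<times> {-1, 1})"

definition VS :: "('a \<Rightarrow> int) set \<Rightarrow> ('a \<times> int) set \<Rightarrow> ('a \<Rightarrow> int) set" where
  "VS F S = {h \<in> F. \<forall>(x, y)\<in>S. h x = y}"

text \<open>Only meaningful for finite \<open>S\<close>.\<close>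
definition n_hat :: "('a \<Rightarrow> int) set \<Rightarrow> ('a \<times> int) set \<Rightarrow> nat" where
  "n_hat F S = (LEAST n. \<exists>C\<subseteq>S. card C = n \<and> VS F C = VS F S)"

text \<open>The random sample of size \<open>m\<close>; the data sequence \<open>Z\<close> is indexed from \<open>0\<close>.\<close>
definition sample :: "(nat \<Rightarrow> 'w \<Rightarrow> 'a \<times> int) \<Rightarrow> nat \<Rightarrow> 'w \<Rightarrow> ('a \<times> int) set" where
  "sample Z m \<omega> = (\<lambda>i. Z i \<omega>) ` {..<m}"

definition B_n_hat ::
    "'w measure \<Rightarrow> (nat \<Rightarrow> 'w \<Rightarrow> 'a \<times> int) \<Rightarrow> ('a \<Rightarrow> int) set \<Rightarrow> nat \<Rightarrow> real \<Rightarrow> nat" where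
  "B_n_hat \<Omega> Z F m \<delta> =
     (LEAST b. measure \<Omega> {\<omega> \<in> space \<Omega>. n_hat F (sample Z m \<omega>) \<le> b} \<ge> 1 - \<delta>)"

definition classifier_ball ::
    "'a measure \<Rightarrow> ('a \<times> int) measure \<Rightarrow> ('a \<Rightarrow> int) set \<Rightarrow> ('a \<Rightarrow> int) \<Rightarrow> real \<Rightarrow> ('a \<Rightarrow> int) set" where
  "classifier_ball M P F f r = {h \<in> F. Delta M P {h, f} \<le> r}"

text \<open>Extended-real-valued because the supremum may be infinite at \<open>r0 = 0\<close>.\<close>
definition dis_coeff ::
    "'a measure \<Rightarrow> ('a \<times> int) measure \<Rightarrow> ('a \<Rightarrow> int) set \<Rightarrow> ('a \<Rightarrow> int) \<Rightarrow> real \<Rightarrow> ereal" where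
  "dis_coeff M P F f r0 =
     max (SUP r\<in>{r0<..}. ereal (Delta M P (classifier_ball M P F f r) / r)) 1"

text \<open>
  Joint measurability, in the sample points labelled by \<open>f\<close> and the query point, of the region of
  disagreement of the version space. For uncountable \<open>F\<close> this is not automatic, and it does not
  follow from measurability of each individual region of disagreement: if \<open>\<prec>\<close> well-orders \<open>[0,1]\<close>
  with countable initial segments (as exists under the continuum hypothesis), the classifiers that
  are \<open>+1\<close> on an initial segment \<open>{y. y \<preceq> x}\<close>, together with the constant \<open>-1\<close> as target, have
  version space compression set size \<open>1\<close> for every nonempty sample, but disagreement coefficient
  \<open>1 / r0\<close> under the uniform distribution.
\<close>
definition DIS_VS_measurable :: "'a measure \<Rightarrow> ('a \<Rightarrow> int) set \<Rightarrow> ('a \<Rightarrow> int) \<Rightarrow> bool" where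
  "DIS_VS_measurable M F f \<longleftrightarrow>
     (\<forall>m::nat. Measurable.pred ((\<Pi>\<^sub>M i\<in>{..<m}. M) \<Otimes>\<^sub>M M)
        (\<lambda>(xs, x). x \<in> DIS M (VS F ((\<lambda>i. (xs i, f (xs i))) ` {..<m}))))"

end

theory Submission
  imports Defs
begin

text \<open>
  Fix \<open>r < 1\<close>, let \<open>m = \<lceil>1 / r\<rceil>\<close>, let \<open>A\<close> be the region of disagreement of the ball of radius \<open>r\<close>,
  and let \<open>\<mu>\<close> be \<open>m\<close> times its probability. Call a sample point critical if it lies in \<open>A\<close> and in the
  region of disagreement of the version space of the other \<open>m - 1\<close> points. A compression set has to
  contain all critical points. Each point of \<open>A\<close> is witnessed by a classifier of the ball differing
  there from the target; it is consistent with the other \<open>m - 1\<close> points with probability at least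
  \<open>(1 - r) ^ (m - 1)\<close>, which exceeds \<open>1 / 5\<close> when \<open>\<mu> > 512\<close>. So the expected number of critical points
  is at least \<open>\<mu> / 5\<close>. It is dominated by the number of sample points in \<open>A\<close>, which has
  mean \<open>\<mu>\<close> and variance at most \<open>\<mu>\<close>; hence more than \<open>\<mu> / 16\<close> points are critical with probability
  above \<open>1 / 20\<close>.
\<close>

section \<open>Critical points and compression sets\<close>

lemma VS_antimono: "S \<subseteq> T \<Longrightarrow> VS F T \<subseteq> VS F S"
  by (fastforce simp: VS_def)

text \<open>All classifiers consistent with \<open>s i\<close> agree at its instance, so removing a
  critical point strictly enlarges the version space. A compression set omitting the point would lie
  in the remaining sample and so have at least this larger version space. Repeated points are never
  critical, so counting indices counts points.\<close>

lemma card_critical_le_n_hat: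
  assumes "finite I"
  shows "card {i \<in> I. fst (s i) \<in> DIS M (VS F (s ` (I - {i})))} \<le> n_hat F (s ` I)"
proof -
  let ?G = "{i \<in> I. fst (s i) \<in> DIS M (VS F (s ` (I - {i})))}"
  have "\<exists>C\<subseteq>s ` I. card C = n_hat F (s ` I) \<and> VS F C = VS F (s ` I)"
    unfolding n_hat_def by (rule LeastI_ex) blast
  then obtain C where C: "C \<subseteq> s ` I" "card C = n_hat F (s ` I)" "VS F C = VS F (s ` I)"
    by blast
  \<comment> \<open>\<open>D\<close> is left free for two uses: the sample without index
    \<open>i\<close>, when another index repeats the point, and the full sample.\<close>
  have differ: "VS F (s ` (I - {i})) \<noteq> VS F D" if "i \<in> ?G" "s i \<in> D" for i D
  proof
    assume eq: "VS F (s ` (I - {i})) = VS F D"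
    have "fst (s i) \<in> DIS M (VS F D)" using that(1) unfolding eq[symmetric] by simp
    then obtain h g where "h \<in> VS F D" "g \<in> VS F D" "h (fst (s i)) \<noteq> g (fst (s i))"
      unfolding DIS_def by blast
    with that(2) show False
      by (cases "s i") (auto simp: VS_def)
  qed
  have inj: "inj_on s ?G"
  proof (rule inj_onI, rule ccontr)
    fix i j assume ij: "i \<in> ?G" "j \<in> ?G" "s i = s j" "i \<noteq> j"
    have "s i \<in> s ` (I - {i})" unfolding ij(3) using ij(2,4) by (intro imageI) simp
    from differ[OF ij(1) this] show False by simp
  qed
  have sub: "s ` ?G \<subseteq> C"
  proof (rule subsetI, rule ccontr)
    fix z assume "z \<in> s ` ?G" "z \<notin> C"
    then obtain i where i: "i \<in> ?G" "z = s i" by blast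
    have "C \<subseteq> s ` (I - {i})" using C(1) \<open>z \<notin> C\<close> i(2) by blast
    then have "VS F (s ` (I - {i})) \<subseteq> VS F C" by (rule VS_antimono)
    moreover have "VS F (s ` I) \<subseteq> VS F (s ` (I - {i}))" by (rule VS_antimono) blast
    ultimately have "VS F (s ` (I - {i})) = VS F (s ` I)" using C(3) by blast
    with differ[OF i(1), of "s ` I"] i show False by auto
  qed
  have "finite C" using C(1) assms finite_surj by blast
  with sub have "card (s ` ?G) \<le> card C" by (rule card_mono[rotated])
  with C(2) show ?thesis by (simp add: card_image[OF inj])
qed

section \<open>Conditioning, counts of events and an elementary bound\<close>

text \<open>Independence makes the joint law of \<open>U\<close> and \<open>V\<close> a product, so
  Fubini integrates the bound on the sections over \<open>A\<close>. This replaces conditioning on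
  \<open>V\<close>.\<close>

lemma (in prob_space) indep_var_prob_sections:
  assumes indep: "indep_var N U K V" and R: "R \<in> sets (N \<Otimes>\<^sub>M K)" and A: "A \<in> sets K"
    and q: "\<And>x. x \<in> A \<Longrightarrow> q \<le> prob {\<omega> \<in> space M. (U \<omega>, x) \<in> R}"
  shows "q * prob {\<omega> \<in> space M. V \<omega> \<in> A} \<le> prob {\<omega> \<in> space M. V \<omega> \<in> A \<and> (U \<omega>, V \<omega>) \<in> R}"
proof -
  have rv[measurable]: "random_variable N U" "random_variable K V"
    and joint: "distr M N U \<Otimes>\<^sub>M distr M K V = distr M (N \<Otimes>\<^sub>M K) (\<lambda>\<omega>. (U \<omega>, V \<omega>))"
    using indep indep_var_distribution_eq by blast+
  note [measurable] = R A
  interpret U: prob_space "distr M N U" by (rule prob_space_distr) simp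
  interpret V: prob_space "distr M K V" by (rule prob_space_distr) simp
  interpret pair_sigma_finite "distr M N U" "distr M K V" ..
  let ?T = "R \<inter> (space N \<times> A)"
  have T: "?T \<in> sets (distr M N U \<Otimes>\<^sub>M distr M K V)" by simp
  have "ennreal (q * prob {\<omega> \<in> space M. V \<omega> \<in> A})
      = (\<integral>\<^sup>+x. ennreal q * indicator A x \<partial>distr M K V)"
    by (subst nn_integral_cmult_indicator)
       (auto simp: emeasure_distr emeasure_eq_measure ennreal_mult'' vimage_def Int_def conj_commute)
  also have "\<dots> \<le> (\<integral>\<^sup>+x. emeasure (distr M N U) ((\<lambda>y. (y, x)) -` ?T) \<partial>distr M K V)"
  proof (intro nn_integral_mono)
    fix x assume x: "x \<in> space (distr M K V)"
    show "ennreal q * indicator A x \<le> emeasure (distr M N U) ((\<lambda>y. (y, x)) -` ?T)"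
    proof (cases "x \<in> A")
      case True
      have "emeasure (distr M N U) ((\<lambda>y. (y, x)) -` ?T) = emeasure M (U -` ((\<lambda>y. (y, x)) -` ?T) \<inter> space M)"
        by (intro emeasure_distr rv sets_Pair2[of _ N K]) simp
      also have "U -` ((\<lambda>y. (y, x)) -` ?T) \<inter> space M = {\<omega> \<in> space M. (U \<omega>, x) \<in> R}"
        using True measurable_space[OF rv(1)] by auto
      finally show ?thesis
        using True q[OF True] by (simp add: emeasure_eq_measure ennreal_leI)
    qed simp
  qed
  also have "\<dots> = emeasure (distr M (N \<Otimes>\<^sub>M K) (\<lambda>\<omega>. (U \<omega>, V \<omega>))) ?T"
    unfolding joint[symmetric] by (rule emeasure_pair_measure_alt2[OF T, symmetric])
  also have "\<dots> = emeasure M ((\<lambda>\<omega>. (U \<omega>, V \<omega>)) -` ?T \<inter> space M)"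
    by (rule emeasure_distr) auto
  also have "(\<lambda>\<omega>. (U \<omega>, V \<omega>)) -` ?T \<inter> space M = {\<omega> \<in> space M. V \<omega> \<in> A \<and> (U \<omega>, V \<omega>) \<in> R}"
    using measurable_space[OF rv(1)] by auto
  finally show ?thesis
    by (simp add: emeasure_eq_measure)
qed

text \<open>Expanding the square leaves covariances of indicators: those off the diagonal vanish by
  pairwise independence, and each diagonal one is \<open>p - p * p\<close>, at most
  \<open>p\<close>.\<close>

lemma (in prob_space) expectation_count_deviation_le:
  fixes p :: real
  assumes "finite I" and E[measurable]: "\<And>i. i \<in> I \<Longrightarrow> E i \<in> events"
    and p: "\<And>i. i \<in> I \<Longrightarrow> prob (E i) = p"
    and indep: "\<And>i j. i \<in> I \<Longrightarrow> j \<in> I \<Longrightarrow> i \<noteq> j \<Longrightarrow> prob (E i \<inter> E j) = p * p"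
  shows "expectation (\<lambda>\<omega>. ((\<Sum>i\<in>I. indicator (E i) \<omega>) - card I * p)\<^sup>2) \<le> card I * p"
proof -
  let ?D = "\<lambda>i \<omega>. indicator (E i) \<omega> - p"
  have int: "integrable M (\<lambda>\<omega>. ?D i \<omega> * ?D j \<omega>)" if "i \<in> I" "j \<in> I" for i j
  proof (rule integrable_const_bound[where B="(1 + \<bar>p\<bar>) * (1 + \<bar>p\<bar>)"])
    have "\<bar>?D l \<omega>\<bar> \<le> 1 + \<bar>p\<bar>" for l \<omega>
      by (auto simp: indicator_def)
    then show "AE \<omega> in M. norm (?D i \<omega> * ?D j \<omega>) \<le> (1 + \<bar>p\<bar>) * (1 + \<bar>p\<bar>)"
      by (auto simp: abs_mult intro!: AE_I2 mult_mono)
  qed (use that in measurable)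
  have cov: "expectation (\<lambda>\<omega>. ?D i \<omega> * ?D j \<omega>) \<le> (if i = j then p else 0)"
    if ij: "i \<in> I" "j \<in> I" for i j
  proof -
    have "?D i \<omega> * ?D j \<omega> = indicator (E i \<inter> E j) \<omega> - p * indicator (E i) \<omega> - p * indicator (E j) \<omega> + p * p" for \<omega>
      by (auto simp: indicator_def algebra_simps)
    then have cov_eq: "expectation (\<lambda>\<omega>. ?D i \<omega> * ?D j \<omega>) = prob (E i \<inter> E j) - p * prob (E i) - p * prob (E j) + p * p"
      using ij by (simp add: prob_space emeasure_eq_measure)
    show ?thesis
      unfolding cov_eq using ij p indep by (cases "i = j") auto
  qed
  have "expectation (\<lambda>\<omega>. ((\<Sum>i\<in>I. indicator (E i) \<omega>) - card I * p)\<^sup>2)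
      = expectation (\<lambda>\<omega>. \<Sum>i\<in>I. \<Sum>j\<in>I. ?D i \<omega> * ?D j \<omega>)"
    by (simp add: power2_eq_square sum_product[symmetric] sum_subtractf)
  also have "\<dots> = (\<Sum>i\<in>I. \<Sum>j\<in>I. expectation (\<lambda>\<omega>. ?D i \<omega> * ?D j \<omega>))"
    using int by (simp add: Bochner_Integration.integral_sum Bochner_Integration.integrable_sum)
  also have "\<dots> \<le> (\<Sum>i\<in>I. \<Sum>j\<in>I. if i = j then p else 0)"
    by (intro sum_mono cov)
  also have "\<dots> = card I * p"
    using \<open>finite I\<close> by simp
  finally show ?thesis .
qed

text \<open>Nothing is known about the joint law of the \<open>H i\<close>, so a priori the mean of
  their count could come from a rare event. Domination by the count of the \<open>E i\<close>, which
  has small variance, rules this out.\<close>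

lemma (in prob_space) prob_many_subevents:
  fixes p :: real
  assumes I: "finite I" and E[measurable]: "\<And>i. i \<in> I \<Longrightarrow> E i \<in> events"
    and p: "\<And>i. i \<in> I \<Longrightarrow> prob (E i) = p"
    and indep: "\<And>i j. i \<in> I \<Longrightarrow> j \<in> I \<Longrightarrow> i \<noteq> j \<Longrightarrow> prob (E i \<inter> E j) = p * p"
    and H[measurable]: "\<And>i. i \<in> I \<Longrightarrow> H i \<in> events"
    and sub: "\<And>i. i \<in> I \<Longrightarrow> H i \<subseteq> E i"
    and Hp: "\<And>i. i \<in> I \<Longrightarrow> p / 5 \<le> prob (H i)"
    and big: "512 < card I * p"
  shows "1 / 20 < prob {\<omega> \<in> space M. card I * p / 16 < card {i \<in> I. \<omega> \<in> H i}}"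
proof -
  define \<mu> where "\<mu> = card I * p"
  have \<mu>: "512 < \<mu>" using big by (simp add: \<mu>_def)
  define G where "G \<omega> = (\<Sum>i\<in>I. indicator (H i) \<omega> :: real)" for \<omega>
  define N where "N \<omega> = (\<Sum>i\<in>I. indicator (E i) \<omega> :: real)" for \<omega>
  have [measurable]: "G \<in> borel_measurable M" "N \<in> borel_measurable M"
    unfolding G_def N_def by measurable
  have G_card: "G \<omega> = card {i \<in> I. \<omega> \<in> H i}" for \<omega>
    using I by (simp add: G_def indicator_def sum.If_cases Int_def)
  define B where "B = {\<omega> \<in> space M. \<mu> / 16 < G \<omega>}"
  have [measurable]: "B \<in> events" unfolding B_def by measurable
  have GN: "G \<omega> \<le> N \<omega>" for \<omega>
    unfolding G_def N_def using sub by (intro sum_mono) (auto simp: indicator_def)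
  have N: "0 \<le> N \<omega>" "N \<omega> \<le> card I" for \<omega>
    unfolding N_def using sum_bounded_above[of I "\<lambda>i. indicator (E i) \<omega>" "1::real"]
    by (auto intro: sum_nonneg)
  have intG: "integrable M G"
    unfolding G_def by (intro Bochner_Integration.integrable_sum integrable_real_indicator)
      (auto simp: emeasure_eq_measure)
  have intN: "integrable M (\<lambda>\<omega>. (N \<omega> - \<mu>)\<^sup>2)"
  proof (intro integrable_const_bound[where B="(card I + \<mu>)\<^sup>2"] AE_I2)
    fix \<omega>
    have "\<bar>N \<omega> - \<mu>\<bar> \<le> card I + \<mu>" using N[of \<omega>] \<mu> by (simp add: abs_le_iff)
    then show "norm ((N \<omega> - \<mu>)\<^sup>2) \<le> (card I + \<mu>)\<^sup>2"
      using power_mono[of "\<bar>N \<omega> - \<mu>\<bar>" "card I + \<mu>" 2] by simp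
  qed simp
  text \<open>On \<open>B\<close> the excess \<open>N - \<mu>\<close> is bounded by AM-GM, with weights chosen so that \<open>E (N - \<mu>)\<^sup>2 \<le> \<mu>\<close> suffices.\<close>
  have pt: "G \<omega> - \<mu> / 16 \<le> \<mu> * indicator B \<omega> + 8 / \<mu> * (N \<omega> - \<mu>)\<^sup>2 + \<mu> / 32" if "\<omega> \<in> space M" for \<omega>
  proof -
    have "0 \<le> 8 / \<mu> * (N \<omega> - \<mu> - \<mu> / 16)\<^sup>2" using \<mu> by simp
    also have "\<dots> = 8 / \<mu> * (N \<omega> - \<mu>)\<^sup>2 + \<mu> / 32 - (N \<omega> - \<mu>)"
      using \<mu> by (simp add: power2_eq_square field_simps)
    finally have 1: "N \<omega> - \<mu> \<le> 8 / \<mu> * (N \<omega> - \<mu>)\<^sup>2 + \<mu> / 32" by simp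
    have 2: "0 \<le> 8 / \<mu> * (N \<omega> - \<mu>)\<^sup>2 + \<mu> / 32" using \<mu> by (intro add_nonneg_nonneg mult_nonneg_nonneg) auto
    show ?thesis
    proof (cases "\<omega> \<in> B")
      case True
      then have "\<mu> * indicator B \<omega> = \<mu>" by simp
      then show ?thesis using 1 GN[of \<omega>] \<mu> by linarith
    next
      case False
      then have "\<mu> * indicator B \<omega> = 0" "G \<omega> \<le> \<mu> / 16" using that by (auto simp: B_def)
      then show ?thesis using 2 by linarith
    qed
  qed
  have "\<mu> / 5 = (\<Sum>i\<in>I. p / 5)" by (simp add: \<mu>_def)
  also have "\<dots> \<le> (\<Sum>i\<in>I. prob (H i))" by (intro sum_mono Hp)
  also have "\<dots> = expectation G"
    unfolding G_def by (simp add: Bochner_Integration.integral_sum emeasure_eq_measure)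
  finally have "\<mu> / 5 - \<mu> / 16 \<le> expectation (\<lambda>\<omega>. G \<omega> - \<mu> / 16)"
    using intG by (simp add: prob_space)
  also have "\<dots> \<le> expectation (\<lambda>\<omega>. \<mu> * indicator B \<omega> + 8 / \<mu> * (N \<omega> - \<mu>)\<^sup>2 + \<mu> / 32)"
    using intG intN pt by (intro integral_mono) (auto simp: emeasure_eq_measure)
  also have "\<dots> = \<mu> * prob B + 8 / \<mu> * expectation (\<lambda>\<omega>. (N \<omega> - \<mu>)\<^sup>2) + \<mu> / 32"
    using intN by (simp add: prob_space emeasure_eq_measure)
  also have "\<dots> \<le> \<mu> * prob B + 8 / \<mu> * \<mu> + \<mu> / 32"
    using expectation_count_deviation_le[OF I E p indep] \<mu>
    by (intro add_mono mult_left_mono) (auto simp: N_def \<mu>_def)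
  \<comment> \<open>The threshold 512 enters here, through 8 < \<mu> / 64. What remains is 1/5 -
    1/16 - 1/32 - 1/64 = 29/320, which exceeds 1/20.\<close>
  also have "\<dots> < \<mu> * prob B + \<mu> / 64 + \<mu> / 32" using \<mu> by simp
  finally have "\<mu> * (1 / 20) < \<mu> * prob B" using \<mu> by linarith
  then have "1 / 20 < prob B" using \<mu> by (subst (asm) mult_less_cancel_left_pos) auto
  then show ?thesis by (simp add: B_def G_card \<mu>_def)
qed

text \<open>Bernoulli's inequality with exponent \<open>k\<close> gives only
  \<open>1 - k * r\<close>, which may be 0. With half the exponent, rounded up, it gives nearly 1/2;
  squaring yields nearly 1/4, and the slack down to 1/5 absorbs the rounding.\<close>

lemma power_one_minus_ge_fifth:
  fixes r :: real
  assumes "0 \<le> r" "r \<le> 1 / 512" "k * r \<le> 1"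
  shows "1 / 5 \<le> (1 - r) ^ k"
proof -
  define j where "j = (k + 1) div 2"
  have j: "k \<le> 2 * j" "2 * j \<le> k + 1" by (auto simp: j_def)
  have "j * r \<le> (k + 1) / 2 * r" using j assms by (intro mult_right_mono) auto
  also have "\<dots> \<le> 513 / 1024" using assms by (simp add: algebra_simps)
  finally have "511 / 1024 \<le> 1 - j * r" by simp
  also have "\<dots> \<le> (1 - r) ^ j"
    using Bernoulli_inequality[of "- r" j] assms by simp
  finally have "(511 / 1024)\<^sup>2 \<le> ((1 - r) ^ j)\<^sup>2" by (intro power_mono) auto
  also have "\<dots> = (1 - r) ^ (2 * j)" by (simp add: power_mult[symmetric] mult.commute)
  also have "\<dots> \<le> (1 - r) ^ k" using j assms by (intro power_decreasing) auto
  finally show ?thesis by (simp add: power2_eq_square)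
qed


section \<open>The disagreement ratio of one ball\<close>

lemma n_hat_le_card: "n_hat F S \<le> card S"
  unfolding n_hat_def by (rule Least_le) blast

text \<open>With \<open>m\<close> the ceiling of 1/r and \<open>p\<close> the probability of the
  region \<open>A\<close>, the ratio is at most \<open>m * p\<close>. If this exceeds 512, more than
  \<open>m * p / 16\<close> points are critical with probability above 1/20; this event must meet
  the one, of probability at least 19/20, on which \<open>n_hat\<close> is at most
  \<open>B_n_hat\<close>.\<close>

lemma disagreement_ball_ratio_le:
  fixes M :: "'a measure"
    and P :: "('a \<times> int) measure"
    and \<Omega> :: "'w measure"
    and r :: real
  assumes F: "F \<subseteq> classifiers M"
    and "prob_space P"
    and P_sets: "sets P = sets (M \<Otimes>\<^sub>M label_space)"
    and f: "f \<in> F"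
    and "prob_space \<Omega>"
    and Z_indep: "prob_space.indep_vars \<Omega> (\<lambda>_. P) Z UNIV"
    and Z_distr: "\<And>i. distr \<Omega> P (Z i) = P"
    and Z_label: "\<And>i \<omega>. \<omega> \<in> space \<Omega> \<Longrightarrow> snd (Z i \<omega>) = f (fst (Z i \<omega>))"
    and VS_meas: "DIS_VS_measurable M F f"
    and r: "0 < r"
  shows "Delta M P (classifier_ball M P F f r) / r
    \<le> max (16 * B_n_hat \<Omega> Z F (nat \<lceil>1 / r\<rceil>) (1 / 20)) 512"
proof -
  interpret P: prob_space P by fact
  interpret prob_space \<Omega> by fact
  define A where "A = DIS M (classifier_ball M P F f r)"
  define p where "p = Delta M P (classifier_ball M P F f r)"
  define m where "m = nat \<lceil>1 / r\<rceil>"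
  define X where "X = (\<lambda>i \<omega>. fst (Z i \<omega>))"
  have p: "p = measure P (A \<times> {-1, 1})" by (simp add: p_def A_def Delta_def)
  have p0: "0 \<le> p" and p1: "p \<le> 1" by (auto simp: p)
  have m: "1 / r \<le> m" "real m < 1 / r + 1"
    using r unfolding m_def by (simp_all add: of_nat_nat) linarith+
  show ?thesis
  proof (cases "m * p \<le> 512")
    case True
    have "p / r \<le> m * p" using mult_right_mono[OF m(1) p0] by simp
    with True show ?thesis by (simp add: p_def)
  next
    case False
    have P_space: "space P = space M \<times> {-1, 1}"
      using sets_eq_imp_space_eq[OF P_sets] by (simp add: space_pair_measure label_space_def)
    have fst_P: "fst \<in> P \<rightarrow>\<^sub>M M"
      by (subst measurable_cong_sets[OF P_sets refl]) simp
    have Z_rv[measurable]: "Z i \<in> \<Omega> \<rightarrow>\<^sub>M P" for i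
      using Z_indep by (auto simp: indep_vars_def)
    have X_indep: "indep_vars (\<lambda>_. M) X UNIV"
      unfolding X_def by (rule indep_vars_compose2[OF Z_indep fst_P])
    have X_rv[measurable]: "X i \<in> \<Omega> \<rightarrow>\<^sub>M M" for i
      using X_indep by (auto simp: indep_vars_def)
    have Z_eq: "Z i \<omega> = (X i \<omega>, f (X i \<omega>))" if "\<omega> \<in> space \<Omega>" for i \<omega>
      using Z_label[OF that, of i] by (cases "Z i \<omega>") (simp add: X_def)
    have X_prob: "prob (X i -` B \<inter> space \<Omega>) = measure P (B \<times> {-1, 1})" if B: "B \<in> sets M" for i B
    proof -
      have "measure P (B \<times> {-1, 1}) = measure (distr \<Omega> P (Z i)) (B \<times> {-1, 1})"
        by (simp add: Z_distr)
      also have "\<dots> = prob (Z i -` (B \<times> {-1, 1}) \<inter> space \<Omega>)"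
        using B by (intro measure_distr Z_rv) (auto simp: P_sets label_space_def)
      also have "Z i -` (B \<times> {-1, 1}) \<inter> space \<Omega> = X i -` B \<inter> space \<Omega>"
        using measurable_space[OF Z_rv[of i]] by (fastforce simp: X_def P_space)
      finally show ?thesis by simp
    qed

    text \<open>If the region of disagreement were not measurable, its \<^const>\<open>measure\<close> would be the junk value \<open>0\<close>.\<close>
    have "A \<times> {-1, 1} \<in> sets (M \<Otimes>\<^sub>M label_space)"
      using False measure_notin_sets[of "A \<times> {-1, 1}" P] by (intro ccontr[of "_ \<in> _"]) (simp add: p P_sets)
    from sets_Pair2[OF this, of 1] have A[measurable]: "A \<in> sets M"
      by (simp add: vimage_def)

    \<comment> \<open>\<open>k\<close> counts the sample points besides a given one. The ceiling
      exceeds 1/r by less than 1, so \<open>k * r\<close> \<le> 1; since \<open>m * p\<close> > 512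
      and \<open>p\<close> \<le> 1 force \<open>k\<close> \<ge> 512, also \<open>r\<close> \<le>
      1/512.\<close>
    define k where "k = m - 1"
    have "m * p \<le> m" using p1 by (simp add: mult_left_le)
    with False have "512 < m" by linarith
    then have k: "512 \<le> k" "real k = m - 1" by (auto simp: k_def)
    have "real k < 1 / r" using k m by linarith
    then have "k * r \<le> 1" using r by (simp add: field_simps)
    moreover have "512 * r \<le> k * r" using k r by (intro mult_right_mono) auto
    ultimately have r_small: "r \<le> 1 / 512" and "k * r \<le> 1"
      by simp_all
    then have r_power: "1 / 5 \<le> (1 - r) ^ k"
      using r by (intro power_one_minus_ge_fifth) auto

    \<comment> \<open>A classifier in the ball differs from \<open>f\<close> at a random instance
      with probability at most \<open>r\<close>, and the \<open>k\<close> instances other than the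
      one at \<open>i\<close> are independent.\<close>
    have consistent: "1 / 5 \<le> prob (\<Inter>j\<in>{..<m} - {i}. X j -` {x \<in> space M. h x = f x} \<inter> space \<Omega>)"
      (is "_ \<le> prob (\<Inter>j\<in>?J. X j -` ?S \<inter> _)")
      if i: "i < m" and h: "h \<in> F" "Delta M P {h, f} \<le> r" for i h
    proof -
      have classifier: "g \<in> M \<rightarrow>\<^sub>M count_space UNIV" if "g \<in> F" for g
      proof -
        have "g \<in> M \<rightarrow>\<^sub>M label_space" using F that unfolding classifiers_def by blast
        moreover have "(\<lambda>y. y) \<in> label_space \<rightarrow>\<^sub>M count_space UNIV" by (simp add: label_space_def)
        ultimately show ?thesis by (rule measurable_compose)
      qed
      note [measurable] = classifier[OF f] classifier[OF h(1)]
      have S: "?S \<in> sets M" by measurable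
      have "DIS M {h, f} \<times> {-1, 1} = space P - ?S \<times> {-1, 1}"
        by (auto simp: DIS_def P_space)
      moreover have "?S \<times> {-1, 1} \<in> sets P"
        using S by (auto simp: P_sets label_space_def)
      ultimately have S_prob: "1 - r \<le> measure P (?S \<times> {-1, 1})"
        using h(2) P.prob_compl[of "?S \<times> {-1, 1}"] by (simp add: Delta_def)
      have card_J: "card ?J = k" using i by (simp add: k_def)
      \<comment> \<open>Nonemptiness matters: an intersection over no indices would be
        \<open>UNIV\<close>, not the sample space.\<close>
      with k have J: "?J \<noteq> {}" by (metis card.empty not_numeral_le_zero)
      have "1 / 5 \<le> (\<Prod>j\<in>?J. 1 - r)" using r_power by (simp add: card_J[simplified])
      also have "\<dots> \<le> (\<Prod>j\<in>?J. prob (X j -` ?S \<inter> space \<Omega>))"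
        unfolding X_prob[OF S] using S_prob r_small by (intro prod_mono) auto
      also have "\<dots> = prob (\<Inter>j\<in>?J. X j -` ?S \<inter> space \<Omega>)"
        using J S by (intro indep_varsD[OF X_indep, symmetric]) auto
      finally show ?thesis .
    qed

    define E where "E i = X i -` A \<inter> space \<Omega>" for i
    define H where
      "H i = {\<omega> \<in> space \<Omega>. X i \<omega> \<in> A \<and> X i \<omega> \<in> DIS M (VS F ((\<lambda>j. Z j \<omega>) ` ({..<m} - {i})))}" for i
    \<comment> \<open>\<open>H i\<close> is the event that point \<open>i\<close> is critical. It is
      bounded by fixing this point, carried by \<open>V\<close>, and averaging over the others,
      carried by \<open>U\<close>.\<close>
    have H: "H i \<in> events \<and> p / 5 \<le> prob (H i)" if i: "i < m" for i
    proof -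
      let ?J = "{..<m} - {i}" and ?N = "\<Pi>\<^sub>M j\<in>{..<k}. M" and ?K = "\<Pi>\<^sub>M j\<in>{i}. M"
      have "card {..<k} = card ?J" using i by (simp add: k_def)
      \<comment> \<open>The measurability hypothesis concerns samples indexed by an initial segment,
        so the indices other than \<open>i\<close> are renumbered.\<close>
      then obtain \<sigma> where \<sigma>: "bij_betw \<sigma> {..<k} ?J"
        using finite_same_card_bij[of "{..<k}" ?J] by auto
      then have \<sigma>_in: "\<sigma> j \<in> ?J" if "j < k" for j using that by (auto dest!: bij_betwE)
      define U where "U \<omega> = (\<lambda>j\<in>{..<k}. X (\<sigma> j) \<omega>)" for \<omega>
      \<comment> \<open>\<open>V\<close> is a function on a singleton because independence of
        disjoint blocks is expressed through restrictions to index sets.\<close>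
      define V where "V \<omega> = (\<lambda>j\<in>{i}. X j \<omega>)" for \<omega>
      define R where "R = {z \<in> space (?N \<Otimes>\<^sub>M ?K).
        snd z i \<in> DIS M (VS F ((\<lambda>j. (fst z j, f (fst z j))) ` {..<k}))}"
      \<comment> \<open>\<open>R\<close> is measurable as the pullback of the jointly measurable
        region of disagreement along evaluation of the second component at \<open>i\<close>.\<close>
      have "(\<lambda>z. (fst z, snd z i)) \<in> ?N \<Otimes>\<^sub>M ?K \<rightarrow>\<^sub>M ?N \<Otimes>\<^sub>M M" by measurable
      moreover have "Measurable.pred (?N \<Otimes>\<^sub>M M) (\<lambda>(xs, x). x \<in> DIS M (VS F ((\<lambda>j. (xs j, f (xs j))) ` {..<k})))"
        using VS_meas by (simp add: DIS_VS_measurable_def)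
      ultimately have "Measurable.pred (?N \<Otimes>\<^sub>M ?K) (\<lambda>z. case (fst z, snd z i) of (xs, x) \<Rightarrow>
          x \<in> DIS M (VS F ((\<lambda>j. (xs j, f (xs j))) ` {..<k})))"
        by (rule measurable_compose)
      then have R[measurable]: "R \<in> sets (?N \<Otimes>\<^sub>M ?K)"
        unfolding R_def by (intro predE) simp
      define A' where "A' = {v \<in> space ?K. v i \<in> A}"
      have A'[measurable]: "A' \<in> sets ?K" unfolding A'_def by measurable
      have "indep_var ?N ((\<lambda>xs. \<lambda>j\<in>{..<k}. xs (\<sigma> j)) \<circ> (\<lambda>\<omega>. restrict (\<lambda>j. X j \<omega>) ?J))
          ?K ((\<lambda>v. v) \<circ> (\<lambda>\<omega>. restrict (\<lambda>j. X j \<omega>) {i}))"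
        using \<sigma>_in
        by (intro indep_var_compose[OF indep_var_restrict[OF X_indep]]
            measurable_restrict measurable_component_singleton) auto
      moreover have "(\<lambda>xs. \<lambda>j\<in>{..<k}. xs (\<sigma> j)) \<circ> (\<lambda>\<omega>. restrict (\<lambda>j. X j \<omega>) ?J) = U"
        using \<sigma>_in by (auto simp: U_def fun_eq_iff restrict_def)
      moreover have "(\<lambda>v. v) \<circ> (\<lambda>\<omega>. restrict (\<lambda>j. X j \<omega>) {i}) = V" by (auto simp: V_def)
      ultimately have UV: "indep_var ?N U ?K V" by simp
      have U_rv[measurable]: "U \<in> \<Omega> \<rightarrow>\<^sub>M ?N" and V_rv[measurable]: "V \<in> \<Omega> \<rightarrow>\<^sub>M ?K"
        using indep_var_rv1[OF UV] indep_var_rv2[OF UV] by auto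
      have V_i[simp]: "V \<omega> i = X i \<omega>" for \<omega> by (simp add: V_def)
      \<comment> \<open>Here \<open>v\<close> is arbitrary: the value \<open>V \<omega>\<close>
        identifies \<open>H i\<close>, while a fixed \<open>v\<close> describes a section of
        \<open>R\<close>.\<close>
      have R_iff: "(U \<omega>, v) \<in> R \<longleftrightarrow> v i \<in> DIS M (VS F ((\<lambda>j. Z j \<omega>) ` ?J))"
        if \<omega>: "\<omega> \<in> space \<Omega>" and v: "v \<in> space ?K" for \<omega> v
      proof -
        have "(\<lambda>j. (U \<omega> j, f (U \<omega> j))) ` {..<k} = (\<lambda>j. Z (\<sigma> j) \<omega>) ` {..<k}"
          by (intro image_cong) (auto simp: U_def Z_eq[OF \<omega>])
        also have "\<dots> = (\<lambda>j. Z j \<omega>) ` ?J"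
          by (simp add: bij_betw_imp_surj_on[OF \<sigma>, symmetric] image_image)
        finally have "(\<lambda>j. (U \<omega> j, f (U \<omega> j))) ` {..<k} = (\<lambda>j. Z j \<omega>) ` ?J" .
        then show ?thesis
          using measurable_space[OF U_rv \<omega>] v by (simp add: R_def space_pair_measure)
      qed
      have H_eq: "H i = {\<omega> \<in> space \<Omega>. V \<omega> \<in> A' \<and> (U \<omega>, V \<omega>) \<in> R}"
        unfolding H_def A'_def using R_iff measurable_space[OF V_rv] by auto
      have "1 / 5 \<le> prob {\<omega> \<in> space \<Omega>. (U \<omega>, v) \<in> R}" if v: "v \<in> A'" for v
      proof -
        from v have v_K: "v \<in> space ?K" and v_A: "v i \<in> A" by (auto simp: A'_def)
        then obtain h g where "h \<in> classifier_ball M P F f r" "g \<in> classifier_ball M P F f r"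
          "h (v i) \<noteq> g (v i)"
          unfolding A_def DIS_def by blast
        \<comment> \<open>Two classifiers that differ at a point cannot both agree with
          \<open>f\<close> there.\<close>
        then obtain h where h: "h \<in> F" "Delta M P {h, f} \<le> r" "h (v i) \<noteq> f (v i)"
          unfolding classifier_ball_def by (cases "h (v i) = f (v i)") auto
        \<comment> \<open>If \<open>h\<close> agrees with \<open>f\<close> on the other points, both
          lie in their version space, and they disagree at \<open>v i\<close>.\<close>
        have "(\<Inter>j\<in>?J. X j -` {x \<in> space M. h x = f x} \<inter> space \<Omega>) \<subseteq> {\<omega> \<in> space \<Omega>. (U \<omega>, v) \<in> R}"
        proof
          fix \<omega> assume \<omega>: "\<omega> \<in> (\<Inter>j\<in>?J. X j -` {x \<in> space M. h x = f x} \<inter> space \<Omega>)"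
          have "card ?J = k" using i by (simp add: k_def)
          with k have "?J \<noteq> {}" by (metis card.empty not_numeral_le_zero)
          with \<omega> have \<omega>': "\<omega> \<in> space \<Omega>" and agree: "\<forall>j\<in>?J. h (X j \<omega>) = f (X j \<omega>)"
            by blast+
          from agree h(1) f have "h \<in> VS F ((\<lambda>j. Z j \<omega>) ` ?J)" "f \<in> VS F ((\<lambda>j. Z j \<omega>) ` ?J)"
            by (simp_all add: VS_def Z_eq[OF \<omega>'])
          moreover have "v i \<in> space M" using v_A by (simp add: A_def DIS_def)
          ultimately have "v i \<in> DIS M (VS F ((\<lambda>j. Z j \<omega>) ` ?J))" using h(3) unfolding DIS_def by blast
          with \<omega>' v_K show "\<omega> \<in> {\<omega> \<in> space \<Omega>. (U \<omega>, v) \<in> R}" by (simp add: R_iff)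
        qed
        moreover have "{\<omega> \<in> space \<Omega>. (U \<omega>, v) \<in> R} \<in> events" using v_K by measurable
        ultimately show ?thesis
          using consistent[OF i h(1,2)] finite_measure_mono order_trans by blast
      qed
      from indep_var_prob_sections[OF UV R A' this]
      have "1 / 5 * prob {\<omega> \<in> space \<Omega>. V \<omega> \<in> A'} \<le> prob (H i)"
        by (simp add: H_eq)
      moreover have "{\<omega> \<in> space \<Omega>. V \<omega> \<in> A'} = X i -` A \<inter> space \<Omega>"
        using measurable_space[OF V_rv] by (auto simp: A'_def)
      moreover have "H i \<in> events" unfolding H_eq by measurable
      ultimately show ?thesis by (simp add: X_prob[OF A] p)
    qed

    have E_pair: "prob (E i \<inter> E j) = p * p" if "i \<noteq> j" for i j
      using indep_varsD[OF X_indep, of "{i, j}" "\<lambda>_. A"] that A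
      by (simp add: E_def X_prob[OF A] p)
    have many: "1 / 20 < prob {\<omega> \<in> space \<Omega>. m * p / 16 < card {i \<in> {..<m}. \<omega> \<in> H i}}" (is "_ < prob ?V")
      using prob_many_subevents[of "{..<m}" E p H] H E_pair False
      by (auto simp: E_def H_def X_prob[OF A] p)

    define b where "b = B_n_hat \<Omega> Z F m (1 / 20)"
    let ?W = "{\<omega> \<in> space \<Omega>. n_hat F (sample Z m \<omega>) \<le> b}"
    \<comment> \<open>The minimum defining \<open>B_n_hat\<close> is attained, because the bound
      \<open>m\<close> holds surely.\<close>
    have "n_hat F (sample Z m \<omega>) \<le> m" for \<omega>
      using n_hat_le_card[of F "sample Z m \<omega>"] card_image_le[of "{..<m}" "\<lambda>i. Z i \<omega>"]
      by (simp add: sample_def)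
    then have "prob {\<omega> \<in> space \<Omega>. n_hat F (sample Z m \<omega>) \<le> m} \<ge> 1 - 1 / 20"
      by (simp add: prob_space)
    then have W: "1 - 1 / 20 \<le> prob ?W"
      unfolding b_def B_n_hat_def by (rule LeastI)
    have "m * p \<le> 16 * b"
    proof (rule ccontr)
      assume "\<not> m * p \<le> 16 * b"
      then have b: "b < m * p / 16" by simp
      have critical: "card {i \<in> {..<m}. \<omega> \<in> H i} \<le> n_hat F (sample Z m \<omega>)" for \<omega>
      proof -
        have "card {i \<in> {..<m}. \<omega> \<in> H i}
            \<le> card {i \<in> {..<m}. fst (Z i \<omega>) \<in> DIS M (VS F ((\<lambda>j. Z j \<omega>) ` ({..<m} - {i})))}"
          by (intro card_mono) (auto simp: H_def X_def)
        also have "\<dots> \<le> n_hat F (sample Z m \<omega>)"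
          unfolding sample_def by (rule card_critical_le_n_hat) simp
        finally show ?thesis .
      qed
      have disjoint: "?V \<inter> ?W = {}"
      proof (rule ccontr)
        assume "?V \<inter> ?W \<noteq> {}"
        then obtain \<omega> where "m * p / 16 < card {i \<in> {..<m}. \<omega> \<in> H i}" "n_hat F (sample Z m \<omega>) \<le> b"
          by blast
        with b critical[of \<omega>] show False by linarith
      qed
      \<comment> \<open>Measurability of the two sets comes from their positive probability, since
        \<open>measure\<close> is 0 on nonmeasurable sets.\<close>
      have events: "S \<in> events" if "0 < prob S" for S
        using that measure_notin_sets[of S \<Omega>] by (cases "S \<in> events") auto
      have "?V \<in> events" by (rule events) (use many in linarith)
      moreover have "?W \<in> events" by (rule events) (use W in linarith)
      ultimately have "prob (?V \<union> ?W) = prob ?V + prob ?W"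
        using disjoint by (rule finite_measure_Union)
      with prob_le_1[of "?V \<union> ?W"] many W show False by linarith
    qed
    moreover have "p / r \<le> m * p" using mult_right_mono[OF m(1) p0] by simp
    ultimately show ?thesis by (simp add: b_def p_def m_def)
  qed
qed

section \<open>The supremum over all radii\<close>

theorem theorem3:
  fixes M :: "'a measure"
    and P :: "('a \<times> int) measure"
    and F :: "('a \<Rightarrow> int) set"
    and fstar :: "'a \<Rightarrow> int"
    and \<Omega> :: "'w measure"
    and Z :: "nat \<Rightarrow> 'w \<Rightarrow> 'a \<times> int"
    and r0 :: real
  assumes "F \<subseteq> classifiers M"
    and "prob_space P"
    and "sets P = sets (M \<Otimes>\<^sub>M label_space)"
    and "fstar \<in> F"
    and "realizable_by M P fstar"
    and "prob_space \<Omega>"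
    and "prob_space.indep_vars \<Omega> (\<lambda>_. P) Z UNIV"
    and "\<forall>i. distr \<Omega> P (Z i) = P"
    and "\<forall>i. \<forall>\<omega>\<in>space \<Omega>. snd (Z i \<omega>) = fstar (fst (Z i \<omega>))"
    and "DIS_VS_measurable M F fstar"
    and "0 < r0" and "r0 < 1"
  shows "dis_coeff M P F fstar r0 \<le>
    ereal (real (max (MAX r\<in>{r0<..<1}. 16 * B_n_hat \<Omega> Z F (nat \<lceil>1 / r\<rceil>) (1 / 20)) 512))"
proof -
  let ?b = "\<lambda>r. 16 * B_n_hat \<Omega> Z F (nat \<lceil>1 / r\<rceil>) (1 / 20)"
  interpret P: prob_space P by fact
  \<comment> \<open>\<open>Max\<close> is meaningful only on finite sets. Radii above
    \<open>r0\<close> give sample sizes up to the ceiling of 1/r0, hence finitely many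
    values.\<close>
  have "?b ` {r0<..<1} \<subseteq> (\<lambda>m. 16 * B_n_hat \<Omega> Z F m (1 / 20)) ` {..nat \<lceil>1 / r0\<rceil>}"
  proof
    fix y assume "y \<in> ?b ` {r0<..<1}"
    then obtain r where r: "r0 < r" "y = ?b r" by auto
    have "nat \<lceil>1 / r\<rceil> \<le> nat \<lceil>1 / r0\<rceil>"
      using \<open>0 < r0\<close> r(1) by (intro nat_mono ceiling_mono frac_le) simp_all
    with r(2) show "y \<in> (\<lambda>m. 16 * B_n_hat \<Omega> Z F m (1 / 20)) ` {..nat \<lceil>1 / r0\<rceil>}" by blast
  qed
  then have fin: "finite (?b ` {r0<..<1})" by (rule finite_subset) simp
  have "Delta M P (classifier_ball M P F fstar r) / r \<le> real (max (MAX r\<in>{r0<..<1}. ?b r) 512)"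
    if r: "r0 < r" for r
  proof (cases "r < 1")
    case True
    have "Delta M P (classifier_ball M P F fstar r) / r \<le> real (max (?b r) 512)"
      by (rule disagreement_ball_ratio_le) (use assms r in simp_all)
    also have "\<dots> \<le> real (max (MAX r\<in>{r0<..<1}. ?b r) 512)"
    proof -
      have "?b r \<le> (MAX r\<in>{r0<..<1}. ?b r)"
        using r True by (intro Max_ge fin imageI) simp
      then show ?thesis by (intro of_nat_mono max.mono) simp_all
    qed
    finally show ?thesis .
  next
    \<comment> \<open>From radius 1 on, the ratio is at most 1 because \<open>Delta\<close> is a
      probability.\<close>
    case False
    have "Delta M P (classifier_ball M P F fstar r) / r \<le> 1 / 1"
      using False by (intro frac_le) (auto simp: Delta_def)
    then show ?thesis by simp
  qed
  then show ?thesis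
    unfolding dis_coeff_def by (intro max.boundedI SUP_least) auto
qed

end
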